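(* For every non-negative integer $n$, $$\sum_{k=0}^{\lfloor n/2\rfloor}\binom n{2k}2^{-2k}\binom{2k}k=2^{-n}\binom{2n}n,$$ $$\sum_{k=0}^{\lfloor n/2\rfloor}\frac{\binom n{2k}}{2k+1}=\frac{2^n}{n+1},$$ and $$\sum_{k=0}^{\lfloor n/2\rfloor}\frac{\binom n{2k}}{k+1}2^{-2k}\binom{2k}k=\frac{2^{-n+1}}{n+2}(2n+1)\,C_n.$$
   Context: $C_j=\frac1{j+1}\binom{2j}j$ denotes the $j$-th Catalan number, for $j$ a non-negative integer. *)

theory Defs
  imports Complex_Main
begin

definition catalan :: "nat \<Rightarrow> real" where
  "catalan j = 1 / (real j + 1) * real ((2 * j) choose j)"

end

theory Submission
  imports Defs "HOL-Computational_Algebra.Polynomial"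
begin

text \<open>The first and third identities come from comparing coefficients in
  \<open>(1 + x)\<^bsup>2n\<^esup> = (2x + (1 + x\<^sup>2))\<^bsup>n\<^esup>\<close>. The coefficient of \<open>x\<^bsup>n\<^esup>\<close> gives the first one.
  The third one is the difference of the coefficients of \<open>x\<^bsup>n\<^esup>\<close> and \<open>x\<^bsup>n+2\<^esup>\<close>, because
  \<open>C\<^sub>k\<close> is the difference of the binomial coefficients of \<open>2k\<close> over \<open>k\<close> and \<open>k + 1\<close>.
  The second identity is the sum of the binomial coefficients of \<open>n + 1\<close> over odd numbers.\<close>

lemma sum_even_atMost:
  fixes g :: "nat \<Rightarrow> 'a::comm_monoid_add"
  shows "(\<Sum>j\<le>n. if even j then g j else 0) = (\<Sum>k=0..n div 2. g (2 * k))"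
proof -
  have "(\<Sum>j\<le>n. if even j then g j else 0) = (\<Sum>j\<in>{j\<in>{..n}. even j}. g j)"
    by (rule sum.inter_filter[symmetric]) simp
  also have "\<dots> = (\<Sum>k=0..n div 2. g (2 * k))"
    by (rule sum.reindex_bij_witness[of _ "\<lambda>k. 2 * k" "\<lambda>j. j div 2"]) auto
  finally show ?thesis .
qed

text \<open>Multiplying by 1 + x^2 adds the coefficients at \<open>m\<close> and
  \<open>m - 2\<close>, so on even indices the induction step is Pascal's rule. The indices 0 and 1
  have no such predecessor and are treated apart.\<close>

lemma coeff_one_plus_square_power:
  "coeff ([:1, 0, 1:] ^ j :: 'a::comm_semiring_1 poly) m =
     (if even m then of_nat (j choose (m div 2)) else 0)"
proof (induction j arbitrary: m)
  case 0
  then show ?case by (auto simp: binomial_eq_0 elim!: evenE)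
next
  case (Suc j)
  show ?case
  proof (cases "m < 2")
    case True
    then have "m = 0 \<or> m = 1" by auto
    then show ?thesis using Suc by (auto simp: coeff_pCons)
  next
    case False
    then obtain l where "m = Suc (Suc l)"
      by (metis One_nat_def Suc_1 less_Suc0 less_Suc_eq not0_implies_Suc)
    then show ?thesis using Suc by (simp add: add.commute)
  qed
qed

lemma coeff_one_plus_power:
  "coeff ([:1, 1:] ^ n :: 'a::comm_semiring_1 poly) i = of_nat (n choose i)"
proof (induction n arbitrary: i)
  case 0
  then show ?case by (cases i) auto
next
  case (Suc n)
  then show ?case by (cases i) (auto simp: add.commute)
qed

text \<open>The shift \<open>s\<close> serves both coefficients at once: \<open>s = 0\<close> and
  \<open>s = 1\<close> are used below. Scaling by 2^n keeps everything in the natural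
  numbers.\<close>

lemma sum_choose_even_choose:
  "(\<Sum>k=0..n div 2. (n choose (2 * k)) * 2 ^ (n - 2 * k) * ((2 * k) choose (k + s)))
     = (2 * n) choose (n + 2 * s)"
proof -
  have "[:1, 1:]\<^sup>2 = ([:1, 0, 1:] + monom 2 1 :: nat poly)"
    by (simp add: power2_eq_square monom_altdef numeral_2_eq_2)
  then have "[:1, 1:] ^ (2 * n) = ([:1, 0, 1:] + monom 2 1 :: nat poly) ^ n"
    by (simp only: power_mult)
  also have "\<dots> = (\<Sum>j\<le>n. of_nat (n choose j) * [:1, 0, 1:] ^ j * monom 2 1 ^ (n - j))"
    by (rule binomial_ring)
  finally have "coeff ([:1, 1:] ^ (2 * n)) (n + 2 * s) =
      coeff (\<Sum>j\<le>n. of_nat (n choose j) * [:1, 0, 1:] ^ j * monom 2 1 ^ (n - j) :: nat poly) (n + 2 * s)"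
    by (rule arg_cong)
  also have "\<dots> =
      (\<Sum>j\<le>n. if even j then (n choose j) * 2 ^ (n - j) * (j choose (j div 2 + s)) else 0)"
    unfolding coeff_sum
  proof (rule sum.cong)
    fix j assume "j \<in> {..n}"
    \<comment> \<open>The factor (2x)^(n-j) shifts indices by \<open>n - j\<close>; since j \<le> n,
      the truncated subtractions are exact and index \<open>j + 2 * s\<close> of (1 + x^2)^j
      remains, which has the parity of \<open>j\<close>.\<close>
    then have "n + 2 * s - (n - j) = j + 2 * s" "\<not> n + 2 * s < n - j" by auto
    then have "coeff ([:1, 0, 1:] ^ j * monom (2 ^ (n - j)) (n - j)) (n + 2 * s)
        = 2 ^ (n - j) * coeff ([:1, 0, 1:] ^ j :: nat poly) (j + 2 * s)"
      by (simp add: mult.commute[of _ "monom _ _"] coeff_monom_mult)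
    also have "\<dots> = (if even j then 2 ^ (n - j) * (j choose (j div 2 + s)) else 0)"
      unfolding coeff_one_plus_square_power by simp
    finally have "coeff ([:1, 0, 1:] ^ j * monom (2 ^ (n - j)) (n - j)) (n + 2 * s)
        = (if even j then 2 ^ (n - j) * (j choose (j div 2 + s)) else 0)" .
    then show "coeff (of_nat (n choose j) * [:1, 0, 1:] ^ j * monom 2 1 ^ (n - j)) (n + 2 * s) =
        (if even j then (n choose j) * 2 ^ (n - j) * (j choose (j div 2 + s)) else 0)"
      by (simp add: monom_power of_nat_poly mult.assoc)
  qed simp
  also have "\<dots> = (\<Sum>k=0..n div 2. (n choose (2 * k)) * 2 ^ (n - 2 * k) * ((2 * k) choose (k + s)))"
    by (simp add: sum_even_atMost)
  also have "coeff ([:1, 1:] ^ (2 * n)) (n + 2 * s) = (2 * n) choose (n + 2 * s)"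
    by (simp only: coeff_one_plus_power of_nat_id)
  finally show ?thesis by (rule sym)
qed

lemma sum_choose_even_choose_real:
  "(\<Sum>k=0..n div 2. real (n choose (2 * k)) * 2 powi (- 2 * int k) * real ((2 * k) choose (k + s)))
     = 2 powi (- int n) * real ((2 * n) choose (n + 2 * s))"
proof -
  have "(\<Sum>k=0..n div 2. real (n choose (2 * k)) * 2 powi (- 2 * int k) * real ((2 * k) choose (k + s)))
      = (\<Sum>k=0..n div 2. 2 powi (- int n) *
          real ((n choose (2 * k)) * 2 ^ (n - 2 * k) * ((2 * k) choose (k + s))))"
  proof (rule sum.cong)
    fix k assume "k \<in> {0..n div 2}"
    \<comment> \<open>Here 2k \<le> n, so the truncated \<open>n - 2 * k\<close> is the true
      difference.\<close>
    then have "2 powi (- 2 * int k) = (2::real) powi (- int n + int (n - 2 * k))"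
      by (intro arg_cong[where f = "power_int 2"]) auto
    also have "\<dots> = 2 powi (- int n) * 2 ^ (n - 2 * k)"
      by (subst power_int_add) auto
    finally show "real (n choose (2 * k)) * 2 powi (- 2 * int k) * real ((2 * k) choose (k + s)) =
        2 powi (- int n) * real ((n choose (2 * k)) * 2 ^ (n - 2 * k) * ((2 * k) choose (k + s)))"
      by simp
  qed simp
  then show ?thesis
    by (simp only: sum_choose_even_choose flip: sum_distrib_left of_nat_sum)
qed

text \<open>Real subtraction removes the need for k \<le> m: beyond that range both binomial
  coefficients vanish.\<close>

lemma choose_Suc_times: "real (m choose Suc k) * (real k + 1) = real (m choose k) * (real m - real k)"
proof (cases "k \<le> m")
  case True
  \<comment> \<open>Both sides equal \<open>m * ((m - 1) choose k)\<close>.\<close>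
  have "Suc k * (m choose Suc k) = (m - k) * (m choose k)"
    by (metis binomial_absorb_comp binomial_absorption diff_Suc_1 binomial_eq_0_iff)
  then have "real (Suc k * (m choose Suc k)) = real ((m - k) * (m choose k))" by (rule arg_cong)
  then show ?thesis using True by (simp add: of_nat_diff algebra_simps)
qed (simp add: binomial_eq_0)

lemma central_binomial_over_Suc:
  "real ((2 * k) choose k) / (real k + 1) = real ((2 * k) choose k) - real ((2 * k) choose (k + 1))"
  using choose_Suc_times[of "2 * k" k] by (simp add: field_simps)

text \<open>Two ratio steps express everything through the central coefficient; then (n+1)(n+2) -
  n(n-1) = 2(2n+1) gives the numerator.\<close>

lemma central_binomial_diff:
  "real ((2 * n) choose n) - real ((2 * n) choose (n + 2))
     = 2 / (real n + 2) * (2 * real n + 1) * catalan n"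
proof -
  define a b c where abc: "a = real ((2 * n) choose n)" "b = real ((2 * n) choose (n + 1))"
    "c = real ((2 * n) choose (n + 2))"
  have b: "b = a * real n / (real n + 1)"
    using choose_Suc_times[of "2 * n" n] by (simp add: abc field_simps)
  have c: "c = b * (real n - 1) / (real n + 2)"
    using choose_Suc_times[of "2 * n" "n + 1"] by (simp add: abc field_simps)
  have "real n + 1 \<noteq> 0" "real n + 2 \<noteq> 0" by linarith+
  then have "a - c = 2 / (real n + 2) * (2 * real n + 1) * (1 / (real n + 1) * a)"
    unfolding c b by (simp add: divide_simps) algebra
  then show ?thesis by (simp add: abc catalan_def)
qed

lemma sum_choose_even_over_Suc:
  "(\<Sum>k=0..n div 2. real (n choose (2 * k)) / (2 * real k + 1)) = 2 ^ n / (real n + 1)"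
proof -
  \<comment> \<open>Absorption turns the denominator \<open>j + 1\<close> into the constant
    \<open>n + 1\<close>, which leaves the sum.\<close>
  have absorb: "real (n choose j) / (real j + 1) = real (Suc n choose Suc j) / (real n + 1)" for j
  proof -
    have "real (Suc j * (Suc n choose Suc j)) = real (Suc n * (n choose j))"
      by (simp only: binomial_absorption diff_Suc_1)
    then have "(real j + 1) * real (Suc n choose Suc j) = (real n + 1) * real (n choose j)"
      by (simp only: of_nat_mult of_nat_Suc add.commute)
    moreover have "real j + 1 > 0" "real n + 1 > 0" by auto
    ultimately show ?thesis
      by (subst frac_eq_eq) (simp_all only: mult.commute less_imp_neq[symmetric] not_False_eq_True)
  qed
  have "2 * (\<Sum>i\<le>Suc n. if odd i then real (Suc n choose i) else 0) = 2 ^ Suc n"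
    by (rule choose_odd_sum) simp
  \<comment> \<open>Index 0 is even and contributes nothing to the odd sum; the other indices are i
    = j + 1, odd exactly when \<open>j\<close> is even.\<close>
  then have "(\<Sum>j\<le>n. if even j then real (Suc n choose Suc j) else 0) = 2 ^ n"
    by (simp del: binomial_Suc_Suc add: sum.atMost_Suc_shift del: sum.atMost_Suc)
  then have "(\<Sum>k=0..n div 2. real (Suc n choose Suc (2 * k))) = 2 ^ n"
    by (simp only: sum_even_atMost)
  moreover have "(\<Sum>k=0..n div 2. real (n choose (2 * k)) / (2 * real k + 1))
      = (\<Sum>k=0..n div 2. real (Suc n choose Suc (2 * k)) / (real n + 1))"
    using absorb[of "2 * _"] by (intro sum.cong) simp_all
  ultimately show ?thesis by (simp only: sum_divide_distrib[symmetric])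
qed

theorem proposition4:
  fixes n :: nat
  shows "(\<Sum>k=0..n div 2. real (n choose (2 * k)) * 2 powi (- 2 * int k) * real ((2 * k) choose k))
           = (2 :: real) powi (- int n) * real ((2 * n) choose n)
       \<and> (\<Sum>k=0..n div 2. real (n choose (2 * k)) / (2 * real k + 1))
           = 2 ^ n / (real n + 1)
       \<and> (\<Sum>k=0..n div 2. real (n choose (2 * k)) / (real k + 1) * 2 powi (- 2 * int k) * real ((2 * k) choose k))
           = 2 powi (- int n + 1) / (real n + 2) * (2 * real n + 1) * catalan n"
proof (intro conjI)
  let ?t = "\<lambda>s k. real (n choose (2 * k)) * 2 powi (- 2 * int k) * real ((2 * k) choose (k + s))"
  show first: "(\<Sum>k=0..n div 2. real (n choose (2 * k)) * 2 powi (- 2 * int k) * real ((2 * k) choose k))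
      = (2 :: real) powi (- int n) * real ((2 * n) choose n)"
    using sum_choose_even_choose_real[of n 0] by simp
  show "(\<Sum>k=0..n div 2. real (n choose (2 * k)) / (2 * real k + 1)) = 2 ^ n / (real n + 1)"
    by (rule sum_choose_even_over_Suc)
  \<comment> \<open>Writing the Catalan number as a difference splits each summand into the cases
    \<open>s = 0\<close> and \<open>s = 1\<close> of the sum already evaluated.\<close>
  have "real (n choose (2 * k)) / (real k + 1) * 2 powi (- 2 * int k) * real ((2 * k) choose k)
      = ?t 0 k - ?t 1 k" for k
  proof -
    have "real (n choose (2 * k)) / (real k + 1) * 2 powi (- 2 * int k) * real ((2 * k) choose k)
      = real (n choose (2 * k)) * 2 powi (- 2 * int k) * (real ((2 * k) choose k) / (real k + 1))"
      by simp
    then show ?thesis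
      unfolding central_binomial_over_Suc by (simp only: right_diff_distrib add_0_right)
  qed
  then have "(\<Sum>k=0..n div 2. real (n choose (2 * k)) / (real k + 1) * 2 powi (- 2 * int k)
        * real ((2 * k) choose k))
      = 2 powi (- int n) * (real ((2 * n) choose n) - real ((2 * n) choose (n + 2)))"
    by (simp only: sum_subtractf first sum_choose_even_choose_real right_diff_distrib
        mult_0_right mult_1_right add_0_right)
  also have "\<dots> = 2 powi (- int n + 1) / (real n + 2) * (2 * real n + 1) * catalan n"
    \<comment> \<open>The factor 2 of the difference raises the exponent from -n to -n + 1.\<close>
    unfolding central_binomial_diff by (subst power_int_add) simp_all
  finally show "(\<Sum>k=0..n div 2. real (n choose (2 * k)) / (real k + 1) * 2 powi (- 2 * int k)
        * real ((2 * k) choose k))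
      = 2 powi (- int n + 1) / (real n + 2) * (2 * real n + 1) * catalan n" .
qed

end
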